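(* For a real parameter $\alpha\ge 0$ define the following real polynomials in $(x,y)$, where $r^2=x^2+y^2$: $$\beta_{1,\alpha}=r^2+24+\alpha(x+y)+2\alpha^2,\qquad \beta_{2,\alpha}=\alpha(-x+y),$$ $$\gamma_{1,\alpha}=r^2+24-\alpha(x+y)+2\alpha^2,\qquad \gamma_{2,\alpha}=\alpha(-x+y),$$ $$\begin{aligned}P_\alpha={}&r^8+64r^6+1152r^4+9216r^2+36864\\&+\alpha\big(-48x^5+144x^4y+96x^3y^2-768x^3+96x^2y^3+2304x^2y+144xy^4+2304xy^2-48y^5-768y^3\big)\\&+\alpha^2\big(1152r^2+4608\big)\\&+\alpha^3\big(-4x^5+12x^4y+8x^3y^2-64x^3+8x^2y^3+192x^2y+12xy^4+192xy^2-4y^5-64y^3\big)\\&+\alpha^4\big(192r^2+768\big)+\alpha^6\big(8r^2+32\big).\end{aligned}$$ Then $P_\alpha>0$ on $\mathbb{R}^2$, and the function $$\Psi_{2,\alpha}=\frac{\beta_{1,\alpha}(x^2-y^2-\alpha x+\alpha y)+\beta_{2,\alpha}(2xy+\alpha x+\alpha y)}{\sqrt{P_\alpha}}+i\,\frac{\gamma_{1,\alpha}(2xy+\alpha x+\alpha y)+\gamma_{2,\alpha}(x^2-y^2-\alpha x+\alpha y)}{\sqrt{P_\alpha}}$$ is a degree-2 vortex solution on $\mathbb{R}^2$ of the complex sine-Gordon II (CSG2) equation $$\Delta\psi+\frac{(\nabla\psi)^2\bar\psi}{2-|\psi|^2}+\frac12\psi(1-|\psi|^2)(2-|\psi|^2)=0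 .$$ The family is nontrivial (symmetry breaking): for $\alpha>0$ the modulus $|\Psi_{2,\alpha}|$ is not a function of $r$ alone.
   Context: Here $\psi:\mathbb{R}^2\to\mathbb{C}$, $z=x+iy=re^{i\theta}$, and $(\nabla\psi)^2=(\partial_x\psi)^2+(\partial_y\psi)^2$ (no complex conjugation). A degree-$n$ vortex solution is a solution with $|\psi|\to 1$ as $r\to\infty$ whose winding number around circles of large radius is $n$. A vortex solution is called symmetric if its modulus depends only on $r$. At $\alpha=0$ the function $\Psi_{2,0}$ is the radial degree-2 vortex $\Psi_2=\dfrac{(r^2+24)z^2}{\sqrt{r^8+64r^6+1152r^4+9216r^2+36864}}$. *)

theory Defs
  imports "HOL-Complex_Analysis.Complex_Analysis"
begin

definition dx :: "(real \<times> real \<Rightarrow> complex) \<Rightarrow> real \<times> real \<Rightarrow> complex" where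
  "dx \<psi> = (\<lambda>(x, y). vector_derivative (\<lambda>s. \<psi> (s, y)) (at x))"

definition dy :: "(real \<times> real \<Rightarrow> complex) \<Rightarrow> real \<times> real \<Rightarrow> complex" where
  "dy \<psi> = (\<lambda>(x, y). vector_derivative (\<lambda>t. \<psi> (x, t)) (at y))"

definition C1 :: "(real \<times> real \<Rightarrow> complex) \<Rightarrow> bool" where
  "C1 \<psi> \<longleftrightarrow> (\<forall>p. \<psi> differentiable (at p)) \<and> continuous_on UNIV (dx \<psi>) \<and> continuous_on UNIV (dy \<psi>)"

definition C2 :: "(real \<times> real \<Rightarrow> complex) \<Rightarrow> bool" where
  "C2 \<psi> \<longleftrightarrow> C1 \<psi> \<and> C1 (dx \<psi>) \<and> C1 (dy \<psi>)"

definition laplacian :: "(real \<times> real \<Rightarrow> complex) \<Rightarrow> real \<times> real \<Rightarrow> complex" where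
  "laplacian \<psi> p = dx (dx \<psi>) p + dy (dy \<psi>) p"

text \<open>The bilinear square of the gradient: there is no complex conjugation.\<close>

definition grad_sq :: "(real \<times> real \<Rightarrow> complex) \<Rightarrow> real \<times> real \<Rightarrow> complex" where
  "grad_sq \<psi> p = (dx \<psi> p)\<^sup>2 + (dy \<psi> p)\<^sup>2"

text \<open>Classical solutions on the whole plane. The clause \<open>(cmod (\<psi> p))\<^sup>2 \<noteq> 2\<close> makes the
  quotient meaningful, since division by zero yields zero in HOL.\<close>

definition CSG2_solution :: "(real \<times> real \<Rightarrow> complex) \<Rightarrow> bool" where
  "CSG2_solution \<psi> \<longleftrightarrow> C2 \<psi> \<and>
     (\<forall>p. (cmod (\<psi> p))\<^sup>2 \<noteq> 2 \<and>
          laplacian \<psi> p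
          + grad_sq \<psi> p * cnj (\<psi> p) / of_real (2 - (cmod (\<psi> p))\<^sup>2)
          + 1/2 * \<psi> p * of_real (1 - (cmod (\<psi> p))\<^sup>2) * of_real (2 - (cmod (\<psi> p))\<^sup>2) = 0)"

text \<open>The condition at infinity keeps the images of all large circles away from \<open>0\<close>, so their
  winding numbers about \<open>0\<close> are well defined.\<close>

definition vortex_solution :: "int \<Rightarrow> (real \<times> real \<Rightarrow> complex) \<Rightarrow> bool" where
  "vortex_solution n \<psi> \<longleftrightarrow> CSG2_solution \<psi> \<and>
     ((\<lambda>p. cmod (\<psi> p)) \<longlongrightarrow> 1) at_infinity \<and>
     (\<forall>\<^sub>F R in at_top.
        winding_number (\<lambda>t. \<psi> (R * cos (2 * pi * t), R * sin (2 * pi * t))) 0 = of_int n)"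

definition symmetric_modulus :: "(real \<times> real \<Rightarrow> complex) \<Rightarrow> bool" where
  "symmetric_modulus \<psi> \<longleftrightarrow>
     (\<exists>f :: real \<Rightarrow> real. \<forall>x y. cmod (\<psi> (x, y)) = f (sqrt (x\<^sup>2 + y\<^sup>2)))"

definition beta1 :: "real \<Rightarrow> real \<Rightarrow> real \<Rightarrow> real" where
  "beta1 \<alpha> x y = (x^2 + y^2) + 24 + \<alpha> * (x + y) + 2 * \<alpha>^2"

definition beta2 :: "real \<Rightarrow> real \<Rightarrow> real \<Rightarrow> real" where
  "beta2 \<alpha> x y = \<alpha> * (- x + y)"

definition gamma1 :: "real \<Rightarrow> real \<Rightarrow> real \<Rightarrow> real" where
  "gamma1 \<alpha> x y = (x^2 + y^2) + 24 - \<alpha> * (x + y) + 2 * \<alpha>^2"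

definition gamma2 :: "real \<Rightarrow> real \<Rightarrow> real \<Rightarrow> real" where
  "gamma2 \<alpha> x y = \<alpha> * (- x + y)"

text \<open>Even powers \<open>r^(2k)\<close> of the radius are written \<open>(x^2 + y^2)^k\<close>.\<close>

definition P_poly :: "real \<Rightarrow> real \<Rightarrow> real \<Rightarrow> real" where
  "P_poly \<alpha> x y =
     (x^2 + y^2)^4 + 64 * (x^2 + y^2)^3 + 1152 * (x^2 + y^2)^2 + 9216 * (x^2 + y^2) + 36864
     + \<alpha> * (- 48 * x^5 + 144 * x^4 * y + 96 * x^3 * y^2 - 768 * x^3 + 96 * x^2 * y^3
            + 2304 * x^2 * y + 144 * x * y^4 + 2304 * x * y^2 - 48 * y^5 - 768 * y^3)
     + \<alpha>^2 * (1152 * (x^2 + y^2) + 4608)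
     + \<alpha>^3 * (- 4 * x^5 + 12 * x^4 * y + 8 * x^3 * y^2 - 64 * x^3 + 8 * x^2 * y^3
              + 192 * x^2 * y + 12 * x * y^4 + 192 * x * y^2 - 4 * y^5 - 64 * y^3)
     + \<alpha>^4 * (192 * (x^2 + y^2) + 768)
     + \<alpha>^6 * (8 * (x^2 + y^2) + 32)"

definition Psi2 :: "real \<Rightarrow> real \<times> real \<Rightarrow> complex" where
  "Psi2 \<alpha> = (\<lambda>(x, y). Complex
     ((beta1 \<alpha> x y * (x^2 - y^2 - \<alpha> * x + \<alpha> * y) + beta2 \<alpha> x y * (2 * x * y + \<alpha> * x + \<alpha> * y))
        / sqrt (P_poly \<alpha> x y))
     ((gamma1 \<alpha> x y * (2 * x * y + \<alpha> * x + \<alpha> * y) + gamma2 \<alpha> x y * (x^2 - y^2 - \<alpha> * x + \<alpha> * y))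
        / sqrt (P_poly \<alpha> x y)))"

end

theory Submission
  imports Defs
begin

text \<open>Put \<open>z = x + iy\<close>, \<open>s = \<bar>z\<bar>\<^sup>2\<close> and \<open>d = 2\<alpha>(12 + \<alpha>\<^sup>2)(i - 1)\<close>. The numerator of \<open>\<Psi>\<^bsub>2,\<alpha>\<^esub>\<close> collapses to
  \<open>F = (s + 24) z\<^sup>2 + d cnj z\<close>, and \<open>P\<^sub>\<alpha> = \<bar>F\<bar>\<^sup>2 + \<bar>2d - 4z\<^sup>3\<bar>\<^sup>2 + 576 (s + 8)\<^sup>2\<close>. The latter gives
  \<open>P > 0\<close> and \<open>\<bar>\<psi>\<bar> < 1\<close>, and since \<open>P\<close> grows like \<open>s\<^sup>4\<close> while \<open>P - \<bar>F\<bar>\<^sup>2\<close> is \<open>O(s\<^sup>3)\<close>, also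
  \<open>\<bar>\<psi>\<bar> \<rightarrow> 1\<close>. In Wirtinger coordinates the equation becomes a polynomial identity in \<open>z\<close>, \<open>d\<close> and
  their conjugates. On large circles the term \<open>s z\<^sup>2\<close> dominates, so the winding number is that of \<open>z\<^sup>2\<close>.
  For \<open>\<alpha> > 0\<close> the moduli at \<open>i\<close> and \<open>-i\<close> differ.\<close>

section \<open>Wirtinger calculus for complex functions on the real plane\<close>

abbreviation zc :: "real \<times> real \<Rightarrow> complex" where
  "zc p \<equiv> Complex (fst p) (snd p)"

text \<open>\<open>A\<close> and \<open>B\<close> are the derivatives of \<open>F\<close> with
  respect to z and its conjugate. Splitting the real differential this way lets z and
  \<open>cnj z\<close> be treated as independent variables, so that derivatives of polynomials in
  both follow by formal rules.\<close>

definition wirtinger ::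
  "(real \<times> real \<Rightarrow> complex) \<Rightarrow> (real \<times> real \<Rightarrow> complex) \<Rightarrow> (real \<times> real \<Rightarrow> complex) \<Rightarrow> bool" where
  "wirtinger F A B \<longleftrightarrow>
     (\<forall>p. (F has_derivative (\<lambda>h. A p * zc h + B p * cnj (zc h))) (at p))"

text \<open>Separates differentiation from simplification: the sum, product and power rules produce
  raw coefficients, which are then compared pointwise with the intended closed forms.\<close>

lemma wirtinger_eqI:
  assumes "wirtinger F A B" "\<And>p. A p = A' p" "\<And>p. B p = B' p"
  shows "wirtinger F A' B'"
proof -
  have "A = A'" "B = B'"
    using assms(2,3) by auto
  then show ?thesis
    using assms(1) by simp
qed

lemma wirtinger_const: "wirtinger (\<lambda>p. c) (\<lambda>p. 0) (\<lambda>p. 0)"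
  by (simp add: wirtinger_def)

lemma has_derivative_zc: "(zc has_derivative zc) F"
proof (rule bounded_linear_imp_has_derivative)
  show "bounded_linear zc"
    by (rule linear_conv_bounded_linear[THEN iffD1], rule linearI)
       (simp_all add: complex_eq_iff)
qed

lemma wirtinger_zc: "wirtinger zc (\<lambda>p. 1) (\<lambda>p. 0)"
  using has_derivative_zc by (simp add: wirtinger_def)

lemma wirtinger_cnj_zc: "wirtinger (\<lambda>p. cnj (zc p)) (\<lambda>p. 0) (\<lambda>p. 1)"
  using has_derivative_cnj[OF has_derivative_zc] by (simp add: wirtinger_def)

lemma wirtinger_add:
  assumes "wirtinger F A B" "wirtinger G C D"
  shows "wirtinger (\<lambda>p. F p + G p) (\<lambda>p. A p + C p) (\<lambda>p. B p + D p)"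
  unfolding wirtinger_def
proof
  fix p
  show "((\<lambda>p. F p + G p) has_derivative (\<lambda>h. (A p + C p) * zc h + (B p + D p) * cnj (zc h))) (at p)"
    using has_derivative_add[OF assms[unfolded wirtinger_def, rule_format, of p]]
    by (rule has_derivative_eq_rhs) (simp add: algebra_simps fun_eq_iff)
qed

lemma wirtinger_mult:
  assumes "wirtinger F A B" "wirtinger G C D"
  shows "wirtinger (\<lambda>p. F p * G p) (\<lambda>p. A p * G p + F p * C p) (\<lambda>p. B p * G p + F p * D p)"
  unfolding wirtinger_def
proof
  fix p
  show "((\<lambda>p. F p * G p) has_derivative
      (\<lambda>h. (A p * G p + F p * C p) * zc h + (B p * G p + F p * D p) * cnj (zc h))) (at p)"
    using has_derivative_mult[OF assms[unfolded wirtinger_def, rule_format, of p]]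
    by (rule has_derivative_eq_rhs) (simp add: algebra_simps fun_eq_iff)
qed

lemma wirtinger_power:
  assumes "wirtinger F A B"
  shows "wirtinger (\<lambda>p. F p ^ n) (\<lambda>p. of_nat n * F p ^ (n - 1) * A p) (\<lambda>p. of_nat n * F p ^ (n - 1) * B p)"
  unfolding wirtinger_def
proof
  fix p
  show "((\<lambda>p. F p ^ n) has_derivative
      (\<lambda>h. of_nat n * F p ^ (n - 1) * A p * zc h + of_nat n * F p ^ (n - 1) * B p * cnj (zc h))) (at p)"
    using has_derivative_power[OF assms[unfolded wirtinger_def, rule_format, of p], of n]
    by (rule has_derivative_eq_rhs) (simp add: algebra_simps fun_eq_iff)
qed

text \<open>Chain rule with the derivative of \<open>1 / sqrt x\<close> written as
  \<open>- 1/2 * g ^ 3\<close> for \<open>g = 1 / sqrt x\<close>. In this form repeated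
  differentiation produces only powers of \<open>g\<close>.\<close>

lemma wirtinger_inverse_sqrt:
  assumes "wirtinger (\<lambda>p. of_real (P p)) A B" and pos: "\<And>p. P p > 0"
  shows "wirtinger (\<lambda>p. of_real (1 / sqrt (P p)))
           (\<lambda>p. - 1/2 * A p * of_real (1 / sqrt (P p)) ^ 3)
           (\<lambda>p. - 1/2 * B p * of_real (1 / sqrt (P p)) ^ 3)"
  unfolding wirtinger_def
proof
  fix p
  let ?D = "\<lambda>h. A p * zc h + B p * cnj (zc h)"
  let ?g = "1 / sqrt (P p)"
  have D: "((\<lambda>p. complex_of_real (P p)) has_derivative ?D) (at p)"
    using assms(1) unfolding wirtinger_def ..
  have P: "(P has_derivative (\<lambda>h. Re (?D h))) (at p)"
    using has_derivative_Re[OF D] by simp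
  \<comment> \<open>\<open>A\<close> and \<open>B\<close> are complex, but the differential of a
    real-valued function is real: it coincides with its own real part by uniqueness of
    derivatives.\<close>
  have real: "of_real (Re (?D h)) = ?D h" for h
    by (rule fun_cong[OF has_derivative_unique[OF has_derivative_of_real[OF P] D]])
  have "((\<lambda>x. 1 / sqrt x) has_real_derivative - 1/2 * ?g ^ 3) (at (P p))"
    using pos[of p]
    by (auto intro!: derivative_eq_intros simp: field_simps power3_eq_cube)
  from has_derivative_of_real[OF has_derivative_compose[OF P this[THEN has_field_derivative_imp_has_derivative]]]
  have "((\<lambda>p. complex_of_real (1 / sqrt (P p))) has_derivative
          (\<lambda>h. of_real (- 1/2 * ?g ^ 3 * Re (?D h)))) (at p)" .
  then show "((\<lambda>p. complex_of_real (1 / sqrt (P p))) has_derivative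
      (\<lambda>h. - 1/2 * A p * of_real ?g ^ 3 * zc h + - 1/2 * B p * of_real ?g ^ 3 * cnj (zc h))) (at p)"
  proof (rule has_derivative_eq_rhs)
    have "complex_of_real (- 1/2 * ?g ^ 3 * Re (?D h)) =
        - 1/2 * A p * of_real ?g ^ 3 * zc h + - 1/2 * B p * of_real ?g ^ 3 * cnj (zc h)" for h
      unfolding of_real_mult real by (simp add: algebra_simps)
    then show "(\<lambda>h. complex_of_real (- 1/2 * ?g ^ 3 * Re (?D h))) =
        (\<lambda>h. - 1/2 * A p * of_real ?g ^ 3 * zc h + - 1/2 * B p * of_real ?g ^ 3 * cnj (zc h))"
      by blast
  qed
qed

lemma wirtinger_continuous:
  assumes "wirtinger F A B"
  shows "continuous_on UNIV F"
  by (rule has_derivative_continuous_on) (use assms[unfolded wirtinger_def] in blast)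

lemma wirtinger_differentiable:
  assumes "wirtinger F A B"
  shows "F differentiable (at p)"
  using assms unfolding wirtinger_def differentiable_def by blast

lemma wirtinger_dx:
  assumes "wirtinger F A B"
  shows "dx F = (\<lambda>p. A p + B p)"
proof (rule ext)
  fix p :: "real \<times> real"
  obtain x y where p: "p = (x, y)"
    by (cases p)
  have "((\<lambda>s. (s, y)) has_derivative (\<lambda>s. (s, 0))) (at x)"
    by (auto intro!: derivative_eq_intros)
  from has_derivative_compose[OF this assms[unfolded wirtinger_def, rule_format, of "(x, y)"]]
  have "((\<lambda>s. F (s, y)) has_vector_derivative A p + B p) (at x)"
    unfolding has_vector_derivative_def p
    by (rule has_derivative_eq_rhs) (auto simp: fun_eq_iff complex_eq_iff algebra_simps)
  then show "dx F p = A p + B p"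
    by (simp add: dx_def p vector_derivative_at)
qed

text \<open>A step in the y direction is a multiple of i, whose conjugate is -i; hence the minus
  sign in front of \<open>B\<close>.\<close>

lemma wirtinger_dy:
  assumes "wirtinger F A B"
  shows "dy F = (\<lambda>p. \<i> * (A p - B p))"
proof (rule ext)
  fix p :: "real \<times> real"
  obtain x y where p: "p = (x, y)"
    by (cases p)
  have "((\<lambda>t. (x, t)) has_derivative (\<lambda>t. (0, t))) (at y)"
    by (auto intro!: derivative_eq_intros)
  from has_derivative_compose[OF this assms[unfolded wirtinger_def, rule_format, of "(x, y)"]]
  have "((\<lambda>t. F (x, t)) has_vector_derivative \<i> * (A p - B p)) (at y)"
    unfolding has_vector_derivative_def p
    by (rule has_derivative_eq_rhs) (auto simp: fun_eq_iff complex_eq_iff algebra_simps)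
  then show "dy F p = \<i> * (A p - B p)"
    by (simp add: dy_def p vector_derivative_at)
qed

lemma wirtinger_C1:
  assumes "wirtinger F A B" "continuous_on UNIV A" "continuous_on UNIV B"
  shows "C1 F"
  using assms wirtinger_differentiable[OF assms(1)]
  by (auto simp: C1_def wirtinger_dx[OF assms(1)] wirtinger_dy[OF assms(1)] intro!: continuous_intros)

text \<open>\<open>(A + B)^2 - (A - B)^2 = 4 * A * B\<close>.\<close>

lemma wirtinger_grad_sq:
  assumes "wirtinger F A B"
  shows "grad_sq F p = 4 * A p * B p"
  by (simp add: grad_sq_def wirtinger_dx[OF assms] wirtinger_dy[OF assms] power_mult_distrib
      power2_eq_square algebra_simps)

context
  fixes F A B A1 A2 B1 B2
  assumes F: "wirtinger F A B" and A: "wirtinger A A1 A2" and B: "wirtinger B B1 B2"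
begin

lemma wirtinger_dx_dx: "wirtinger (dx F) (\<lambda>p. A1 p + B1 p) (\<lambda>p. A2 p + B2 p)"
  unfolding wirtinger_dx[OF F] by (rule wirtinger_add[OF A B])

lemma wirtinger_dy_dy: "wirtinger (dy F) (\<lambda>p. \<i> * (A1 p - B1 p)) (\<lambda>p. \<i> * (A2 p - B2 p))"
  unfolding wirtinger_dy[OF F]
  using wirtinger_add[OF wirtinger_mult[OF wirtinger_const[of \<i>] A]
      wirtinger_mult[OF wirtinger_const[of "- \<i>"] B]]
  by (simp add: algebra_simps)

text \<open>The pure second derivatives \<open>A1\<close> and \<open>B2\<close> cancel between the
  two directions. If the mixed ones agree, this is the familiar \<open>4 * A2\<close>.\<close>

lemma wirtinger_laplacian: "laplacian F p = 2 * (A2 p + B1 p)"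
  by (simp add: laplacian_def wirtinger_dx[OF wirtinger_dx_dx] wirtinger_dy[OF wirtinger_dy_dy] algebra_simps)

lemma wirtinger_C2:
  assumes "continuous_on UNIV A1" "continuous_on UNIV A2" "continuous_on UNIV B1" "continuous_on UNIV B2"
  shows "C2 F"
  unfolding C2_def
  by (intro conjI wirtinger_C1[OF F] wirtinger_continuous[OF A] wirtinger_continuous[OF B]
      wirtinger_C1[OF wirtinger_dx_dx] wirtinger_C1[OF wirtinger_dy_dy] continuous_intros assms)

end

text \<open>With \<open>g = 1 / sqrt P\<close>, the bilinear gradient square contains
  \<open>g\<close> to the powers 2, 4, 6 and the Laplacian to the powers 1, 3, 5. Multiplying by
  \<open>P ^ 3\<close> and \<open>P ^ 2\<close> and using \<open>g ^ 2 * P = 1\<close> leaves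
  polynomials in the derivatives of \<open>F\<close> and \<open>P\<close>, apart from one common
  factor \<open>g\<close> in the Laplacian.\<close>

lemma
  fixes P :: "real \<times> real \<Rightarrow> real"
  assumes pos: "\<And>p. P p > 0"
    and F: "wirtinger F Fz Fw" and Fz: "wirtinger Fz Fzz Fzw" and Fw: "wirtinger Fw Fzw Fww"
    and P: "wirtinger (\<lambda>p. of_real (P p)) Pz Pw" and Pz: "wirtinger Pz Pzz Pzw" and Pw: "wirtinger Pw Pzw Pww"
    and cont: "continuous_on UNIV Fzz" "continuous_on UNIV Fzw" "continuous_on UNIV Fww"
      "continuous_on UNIV Pzz" "continuous_on UNIV Pzw" "continuous_on UNIV Pww"
  defines "\<psi> \<equiv> \<lambda>p. F p * of_real (1 / sqrt (P p))"
  shows C2_quotient_sqrt: "C2 \<psi>"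
    and grad_sq_quotient_sqrt: "of_real (P p) ^ 3 * grad_sq \<psi> p =
      4 * of_real (P p) ^ 2 * Fz p * Fw p - 2 * F p * of_real (P p) * (Fz p * Pw p + Fw p * Pz p)
      + F p ^ 2 * Pz p * Pw p"
    and laplacian_quotient_sqrt: "of_real (P p) ^ 2 * laplacian \<psi> p = of_real (1 / sqrt (P p)) *
      (4 * of_real (P p) ^ 2 * Fzw p - 2 * of_real (P p) * (Fz p * Pw p + Fw p * Pz p)
       - 2 * F p * of_real (P p) * Pzw p + 3 * F p * Pz p * Pw p)"
proof -
  define g where "g p = complex_of_real (1 / sqrt (P p))" for p
  have g: "wirtinger g (\<lambda>p. - 1/2 * Pz p * g p ^ 3) (\<lambda>p. - 1/2 * Pw p * g p ^ 3)"
    unfolding g_def by (rule wirtinger_inverse_sqrt[OF P pos])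
  have \<psi>_def': "\<psi> = (\<lambda>p. F p * g p)"
    by (simp add: \<psi>_def g_def)
  note \<psi> = wirtinger_mult[OF F g, folded \<psi>_def']
  \<comment> \<open>The rules are composed along the shape of the first-order coefficients of
    \<open>\<psi>\<close>, so that the function differentiated here is literally that
    coefficient.\<close>
  note \<psi>z = wirtinger_add[OF wirtinger_mult[OF Fz g]
      wirtinger_mult[OF F wirtinger_mult[OF wirtinger_mult[OF wirtinger_const[of "- 1/2"] Pz] wirtinger_power[OF g, of 3]]]]
  note \<psi>w = wirtinger_add[OF wirtinger_mult[OF Fw g]
      wirtinger_mult[OF F wirtinger_mult[OF wirtinger_mult[OF wirtinger_const[of "- 1/2"] Pw] wirtinger_power[OF g, of 3]]]]
  note cont' = cont wirtinger_continuous[OF F] wirtinger_continuous[OF Fz] wirtinger_continuous[OF Fw]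
    wirtinger_continuous[OF Pz] wirtinger_continuous[OF Pw] wirtinger_continuous[OF g]
  show "C2 \<psi>"
    by (rule wirtinger_C2[OF \<psi> \<psi>z \<psi>w]) (intro continuous_intros cont')+
  have "(1 / sqrt (P p))\<^sup>2 * P p = 1"
    using pos[of p] by (simp add: power_divide)
  then have gP: "g p ^ 2 * of_real (P p) = 1"
    unfolding g_def by (metis of_real_1 of_real_mult of_real_power)
  let ?P = "complex_of_real (P p)"
  have powers: "?P ^ 3 * g p ^ 2 = ?P ^ 2" "?P ^ 3 * g p ^ 4 = ?P" "?P ^ 3 * g p ^ 6 = 1"
    "?P ^ 2 * g p ^ 3 = ?P * g p" "?P ^ 2 * g p ^ 5 = g p"
  proof -
    have "?P ^ 3 * g p ^ 2 = ?P ^ 2 * (g p ^ 2 * ?P)" "?P ^ 3 * g p ^ 4 = ?P * (g p ^ 2 * ?P) ^ 2"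
      "?P ^ 3 * g p ^ 6 = (g p ^ 2 * ?P) ^ 3" "?P ^ 2 * g p ^ 3 = ?P * g p * (g p ^ 2 * ?P)"
      "?P ^ 2 * g p ^ 5 = g p * (g p ^ 2 * ?P) ^ 2"
      by algebra+
    then show "?P ^ 3 * g p ^ 2 = ?P ^ 2" "?P ^ 3 * g p ^ 4 = ?P" "?P ^ 3 * g p ^ 6 = 1"
      "?P ^ 2 * g p ^ 3 = ?P * g p" "?P ^ 2 * g p ^ 5 = g p"
      unfolding gP by simp_all
  qed
  have "?P ^ 3 * grad_sq \<psi> p = 4 * (?P ^ 3 * g p ^ 2) * Fz p * Fw p
      - 2 * F p * (?P ^ 3 * g p ^ 4) * (Fz p * Pw p + Fw p * Pz p)
      + F p ^ 2 * (?P ^ 3 * g p ^ 6) * Pz p * Pw p"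
    unfolding wirtinger_grad_sq[OF \<psi>] by algebra
  then show "?P ^ 3 * grad_sq \<psi> p =
      4 * ?P ^ 2 * Fz p * Fw p - 2 * F p * ?P * (Fz p * Pw p + Fw p * Pz p)
      + F p ^ 2 * Pz p * Pw p"
    unfolding powers by simp
  \<comment> \<open>The power rule applied to \<open>g ^ 3\<close> leaves the exponent
    \<open>3 - 1\<close>, which has to be evaluated before comparing polynomials.\<close>
  have three: "3 - 1 = (2::nat)"
    by simp
  have "?P ^ 2 * laplacian \<psi> p = 4 * ?P ^ 2 * g p * Fzw p
      - 2 * (?P ^ 2 * g p ^ 3) * (Fz p * Pw p + Fw p * Pz p)
      - 2 * F p * (?P ^ 2 * g p ^ 3) * Pzw p + 3 * F p * (?P ^ 2 * g p ^ 5) * Pz p * Pw p"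
    unfolding wirtinger_laplacian[OF \<psi> \<psi>z \<psi>w] three of_nat_numeral
    by algebra
  also have "\<dots> = g p *
      (4 * ?P ^ 2 * Fzw p - 2 * ?P * (Fz p * Pw p + Fw p * Pz p)
       - 2 * F p * ?P * Pzw p + 3 * F p * Pz p * Pw p)"
    unfolding powers by algebra
  finally show "?P ^ 2 * laplacian \<psi> p = of_real (1 / sqrt (P p)) *
      (4 * ?P ^ 2 * Fzw p - 2 * ?P * (Fz p * Pw p + Fw p * Pz p)
       - 2 * F p * ?P * Pzw p + 3 * F p * Pz p * Pw p)"
    unfolding g_def .
qed

section \<open>The vortex with complex parameter d and its field equation\<close>

definition vortex_num :: "complex \<Rightarrow> complex \<Rightarrow> complex" where
  "vortex_num d z = (z * cnj z + 24) * z ^ 2 + d * cnj z"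

definition vortex_den :: "complex \<Rightarrow> complex \<Rightarrow> real" where
  "vortex_den d z =
     (cmod (vortex_num d z))\<^sup>2 + (cmod (2 * d - 4 * z ^ 3))\<^sup>2 + 576 * ((cmod z)\<^sup>2 + 8)\<^sup>2"

text \<open>The parameter \<open>d\<close> is an arbitrary complex number until \<open>twist\<close>
  ties it to \<alpha>; \<open>d = 0\<close> gives the radial vortex.\<close>

definition vortex :: "complex \<Rightarrow> real \<times> real \<Rightarrow> complex" where
  "vortex d p = vortex_num d (zc p) * of_real (1 / sqrt (vortex_den d (zc p)))"

lemma vortex_den_gt: "vortex_den d z > (cmod (vortex_num d z))\<^sup>2"
proof -
  have "0 < ((cmod z)\<^sup>2 + 8)\<^sup>2"
    by (metis add_nonneg_pos zero_le_power2 zero_less_numeral zero_less_power)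
  then show ?thesis
    unfolding vortex_den_def by (simp add: add_nonneg_pos)
qed

lemma vortex_den_pos: "vortex_den d z > 0"
  using vortex_den_gt[of d z] by (rule le_less_trans[OF zero_le_power2])

text \<open>The first square contributes \<open>(s + 24) * t\<close> and the second
  \<open>- 8 * t\<close>, whence \<open>(s + 16) * t\<close>. Written as a polynomial in
  \<open>z\<close> and \<open>cnj z\<close>, the denominator becomes accessible to the Wirtinger
  rules.\<close>

lemma vortex_den_eq_poly:
  fixes d z :: complex
  defines "s \<equiv> z * cnj z" and "t \<equiv> cnj d * z ^ 3 + d * cnj z ^ 3"
  shows "of_real (vortex_den d z) =
    s ^ 4 + 64 * s ^ 3 + 1152 * s ^ 2 + 9216 * s + 36864 + (s + 16) * t + d * cnj d * (s + 4)"
proof -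
  have "of_real (vortex_den d z) = vortex_num d z * cnj (vortex_num d z)
      + (2 * d - 4 * z ^ 3) * cnj (2 * d - 4 * z ^ 3) + 576 * (z * cnj z + 8) ^ 2"
    unfolding vortex_den_def
    by (simp only: of_real_add of_real_mult of_real_numeral complex_norm_square
        of_real_power[of "(cmod z)\<^sup>2 + 8"])
  then show ?thesis
    unfolding vortex_num_def s_def t_def complex_cnj_add complex_cnj_diff complex_cnj_mult
      complex_cnj_power complex_cnj_cnj complex_cnj_numeral by algebra
qed

lemma cmod_vortex: "(cmod (vortex d p))\<^sup>2 = (cmod (vortex_num d (zc p)))\<^sup>2 / vortex_den d (zc p)"
  using vortex_den_pos[of d "zc p"]
  by (simp add: vortex_def norm_mult norm_divide power_mult_distrib power_divide)

text \<open>The equation for \<open>F / sqrt P\<close> in Wirtinger form, multiplied by a power of \<open>P\<close> and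
  \<open>2 * P - Q\<close>, where \<open>Q = \<bar>F\<bar>\<^sup>2\<close>; the variables \<open>w\<close>, \<open>e\<close> stand for the conjugates of \<open>z\<close>, \<open>d\<close>.\<close>

lemma CSG2_polynomial_identity:
  fixes z w d e :: complex
  defines "s \<equiv> z * w" and "t \<equiv> e * z ^ 3 + d * w ^ 3"
  defines "dq \<equiv> 4 * s ^ 3 + 192 * s ^ 2 + 2304 * s + 9216"
  defines "F \<equiv> (s + 24) * z ^ 2 + d * w" and "G \<equiv> (s + 24) * w ^ 2 + e * z"
  defines "Fz \<equiv> 3 * z ^ 2 * w + 48 * z" and "Fw \<equiv> z ^ 3 + d" and "Fzw \<equiv> 3 * z ^ 2"
  defines "P \<equiv> s ^ 4 + 64 * s ^ 3 + 1152 * s ^ 2 + 9216 * s + 36864 + (s + 16) * t + d * e * (s + 4)"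
  defines "Pz \<equiv> w * dq + w * t + (s + 16) * (3 * e * z ^ 2) + d * e * w"
    and "Pw \<equiv> z * dq + z * t + (s + 16) * (3 * d * w ^ 2) + d * e * z"
    and "Pzw \<equiv> dq + s * (12 * s ^ 2 + 384 * s + 2304) + 4 * t + d * e"
  defines "Q \<equiv> F * G"
  shows "(2 * P - Q) * (4 * P ^ 2 * Fzw - 2 * P * (Fz * Pw + Fw * Pz) - 2 * F * P * Pzw + 3 * F * Pz * Pw)
    + G * (4 * P ^ 2 * Fz * Fw - 2 * F * P * (Fz * Pw + Fw * Pz) + F ^ 2 * Pz * Pw)
    + F * (P - Q) * (2 * P - Q) ^ 2 / 2 = 0"
  unfolding assms by algebra

text \<open>After substituting the quotient formulas, the left side of the equation is
  \<open>g / (P ^ 2 * (2 * P - Q))\<close> times the polynomial of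
  \<open>CSG2_polynomial_identity\<close>, which vanishes.\<close>

lemma CSG2_solution_vortex: "CSG2_solution (vortex d)"
proof -
  define e where "e = cnj d"
  let ?w = "\<lambda>p. cnj (zc p)"
  let ?s = "\<lambda>p. zc p * ?w p" and ?t = "\<lambda>p. e * zc p ^ 3 + d * ?w p ^ 3"
  \<comment> \<open>\<open>?dq\<close> and \<open>?ddq\<close> are the first and second derivatives
    in s of the part of the denominator free of \<open>d\<close>.\<close>
  let ?dq = "\<lambda>p. 4 * ?s p ^ 3 + 192 * ?s p ^ 2 + 2304 * ?s p + 9216"
  let ?ddq = "\<lambda>p. 12 * ?s p ^ 2 + 384 * ?s p + 2304"
  let ?F = "\<lambda>p. vortex_num d (zc p)" and ?P = "\<lambda>p. vortex_den d (zc p)"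
  let ?Fz = "\<lambda>p. 3 * zc p ^ 2 * ?w p + 48 * zc p" and ?Fw = "\<lambda>p. zc p ^ 3 + d"
  let ?Pz = "\<lambda>p. ?w p * ?dq p + ?w p * ?t p + (?s p + 16) * (3 * e * zc p ^ 2) + d * e * ?w p"
  let ?Pw = "\<lambda>p. zc p * ?dq p + zc p * ?t p + (?s p + 16) * (3 * d * ?w p ^ 2) + d * e * zc p"
  let ?Pzw = "\<lambda>p. ?dq p + ?s p * ?ddq p + 4 * ?t p + d * e"
  let ?Pzz = "\<lambda>p. ?w p ^ 2 * ?ddq p + 6 * e * zc p ^ 2 * ?w p + 6 * (?s p + 16) * e * zc p"
  let ?Pww = "\<lambda>p. zc p ^ 2 * ?ddq p + 6 * d * ?w p ^ 2 * zc p + 6 * (?s p + 16) * d * ?w p"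
  note rules = wirtinger_add wirtinger_mult wirtinger_power wirtinger_zc wirtinger_cnj_zc wirtinger_const
  have F: "wirtinger ?F ?Fz ?Fw"
    unfolding vortex_num_def
    by (rule wirtinger_eqI, (rule rules)+) (simp_all, algebra+)
  have Fz: "wirtinger ?Fz (\<lambda>p. 6 * zc p * ?w p + 48) (\<lambda>p. 3 * zc p ^ 2)"
    by (rule wirtinger_eqI, (rule rules)+) (simp_all)
  have Fw: "wirtinger ?Fw (\<lambda>p. 3 * zc p ^ 2) (\<lambda>p. 0)"
    by (rule wirtinger_eqI, (rule rules)+) (simp_all)
  have P: "wirtinger (\<lambda>p. of_real (?P p)) ?Pz ?Pw"
    unfolding vortex_den_eq_poly e_def[symmetric]
    by (rule wirtinger_eqI, (rule rules)+) (simp_all, algebra+)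
  have Pz: "wirtinger ?Pz ?Pzz ?Pzw"
    by (rule wirtinger_eqI, (rule rules)+) (simp_all, algebra+)
  have Pw: "wirtinger ?Pw ?Pzw ?Pww"
    by (rule wirtinger_eqI, (rule rules)+) (simp_all, algebra+)
  have cont: "continuous_on UNIV (\<lambda>p. 6 * zc p * ?w p + 48)" "continuous_on UNIV (\<lambda>p. 3 * zc p ^ 2)"
      "continuous_on UNIV (\<lambda>p::real \<times> real. 0::complex)"
      "continuous_on UNIV ?Pzz" "continuous_on UNIV ?Pzw" "continuous_on UNIV ?Pww"
    by (intro continuous_intros wirtinger_continuous[OF wirtinger_zc] wirtinger_continuous[OF wirtinger_cnj_zc])+
  note quotient = F Fz Fw P Pz Pw cont
  have \<psi>: "vortex d = (\<lambda>p. ?F p * of_real (1 / sqrt (?P p)))"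
    by (simp add: vortex_def fun_eq_iff)
  have "C2 (vortex d)"
    unfolding \<psi> by (rule C2_quotient_sqrt[OF vortex_den_pos quotient])
  moreover have "(cmod (vortex d p))\<^sup>2 \<noteq> 2 \<and>
          laplacian (vortex d) p
          + grad_sq (vortex d) p * cnj (vortex d p) / of_real (2 - (cmod (vortex d p))\<^sup>2)
          + 1/2 * vortex d p * of_real (1 - (cmod (vortex d p))\<^sup>2) * of_real (2 - (cmod (vortex d p))\<^sup>2) = 0"
    for p
  proof
    define Q where "Q = (cmod (?F p))\<^sup>2"
    define g where "g = complex_of_real (1 / sqrt (?P p))"
    define P' Q' where "P' = complex_of_real (?P p)" and "Q' = complex_of_real Q"
    have pos: "?P p > 0" and less: "Q < ?P p"
      using vortex_den_pos vortex_den_gt by (auto simp: Q_def)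
    have norm: "(cmod (vortex d p))\<^sup>2 = Q / ?P p"
      by (simp add: cmod_vortex Q_def)
    show "(cmod (vortex d p))\<^sup>2 \<noteq> 2"
      using pos less unfolding norm by (simp add: field_simps)
    have P0: "P' \<noteq> 0"
      using pos by (simp add: P'_def)
    have PQ0: "2 * P' - Q' \<noteq> 0"
    proof -
      have "2 * P' - Q' = of_real (2 * ?P p - Q)"
        by (simp add: P'_def Q'_def)
      also have "\<dots> \<noteq> 0"
        using pos less by (simp only: of_real_eq_0_iff)
      finally show ?thesis .
    qed
    have \<psi>p: "vortex d p = ?F p * g" "cnj (vortex d p) = cnj (?F p) * g"
      by (simp_all add: vortex_def g_def)
    have norm': "of_real (2 - (cmod (vortex d p))\<^sup>2) = (2 * P' - Q') / P'"
      "of_real (1 - (cmod (vortex d p))\<^sup>2) = (P' - Q') / P'"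
      unfolding norm using P0 by (simp_all add: P'_def Q'_def field_simps)
    define L where "L = 4 * P' ^ 2 * (3 * zc p ^ 2) - 2 * P' * (?Fz p * ?Pw p + ?Fw p * ?Pz p)
      - 2 * ?F p * P' * ?Pzw p + 3 * ?F p * ?Pz p * ?Pw p"
    define S where "S = 4 * P' ^ 2 * ?Fz p * ?Fw p - 2 * ?F p * P' * (?Fz p * ?Pw p + ?Fw p * ?Pz p)
      + ?F p ^ 2 * ?Pz p * ?Pw p"
    have "P' ^ 2 * laplacian (vortex d) p = g * L"
      unfolding \<psi> P'_def g_def L_def by (rule laplacian_quotient_sqrt[OF vortex_den_pos quotient])
    then have lap: "laplacian (vortex d) p = g * L / P' ^ 2"
      using P0 by (simp add: field_simps)
    have "P' ^ 3 * grad_sq (vortex d) p = S"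
      unfolding \<psi> P'_def S_def by (rule grad_sq_quotient_sqrt[OF vortex_den_pos quotient])
    then have grad: "grad_sq (vortex d) p = S / P' ^ 3"
      using P0 by (simp add: field_simps)
    have P'_eq: "P' = ?s p ^ 4 + 64 * ?s p ^ 3 + 1152 * ?s p ^ 2 + 9216 * ?s p + 36864
        + (?s p + 16) * ?t p + d * e * (?s p + 4)"
      unfolding P'_def e_def by (rule vortex_den_eq_poly)
    have F_eq: "?F p = (?s p + 24) * zc p ^ 2 + d * ?w p"
      "cnj (?F p) = (?s p + 24) * ?w p ^ 2 + e * zc p"
      by (simp_all add: vortex_num_def e_def)
    have Q'_eq: "Q' = ?F p * cnj (?F p)"
      by (simp only: Q'_def Q_def complex_norm_square)
    \<comment> \<open>The identity is used with \<open>w = cnj z\<close> and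
      \<open>e = cnj d\<close>. The conjugate of \<open>F\<close> is replaced before
      \<open>F\<close> itself, so that it turns into the polynomial \<open>G\<close> instead of the
      conjugate of an expanded \<open>F\<close>.\<close>
    have "(2 * P' - Q') * L + cnj (?F p) * S + ?F p * (P' - Q') * (2 * P' - Q') ^ 2 / 2 = 0"
      unfolding L_def S_def Q'_eq F_eq(2) unfolding F_eq(1) P'_eq by (rule CSG2_polynomial_identity)
    moreover have "g * L / P' ^ 2 + S / P' ^ 3 * (cnj (?F p) * g) / ((2 * P' - Q') / P')
        + 1/2 * (?F p * g) * ((P' - Q') / P') * ((2 * P' - Q') / P')
      = g / (P' ^ 2 * (2 * P' - Q')) *
        ((2 * P' - Q') * L + cnj (?F p) * S + ?F p * (P' - Q') * (2 * P' - Q') ^ 2 / 2)"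
    proof -
      \<comment> \<open>The denominators are cleared with atoms in place of P and 2P - Q, which
        keeps their difference structure from being expanded.\<close>
      have aux: "g * L / a ^ 2 + S / a ^ 3 * (c * g) / (b / a) + 1/2 * (f * g) * (k / a) * (b / a)
        = g / (a ^ 2 * b) * (b * L + c * S + f * k * b ^ 2 / 2)"
        if "a \<noteq> 0" "b \<noteq> 0" for a b c f k :: complex
        using that by (simp add: field_simps power2_eq_square power3_eq_cube)
      show ?thesis
        by (rule aux[OF P0 PQ0])
    qed
    ultimately show "laplacian (vortex d) p
          + grad_sq (vortex d) p * cnj (vortex d p) / of_real (2 - (cmod (vortex d p))\<^sup>2)
          + 1/2 * vortex d p * of_real (1 - (cmod (vortex d p))\<^sup>2) * of_real (2 - (cmod (vortex d p))\<^sup>2) = 0"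
      unfolding lap grad norm' unfolding \<psi>p(2) unfolding \<psi>p(1) by simp
  qed
  ultimately show ?thesis
    by (simp add: CSG2_solution_def)
qed

section \<open>Behaviour of the modulus at infinity\<close>

text \<open>The perturbation has modulus \<open>cmod d * r \<le> r ^ 2\<close>, which the term
  \<open>24 * r ^ 2\<close> absorbs.\<close>

lemma vortex_num_bound:
  assumes "cmod z \<ge> 1" "cmod z \<ge> cmod d"
  shows "cmod (vortex_num d z) \<ge> cmod z ^ 4"
proof -
  let ?r = "cmod z"
  have "cmod d * ?r \<le> ?r * ?r"
    using assms by (intro mult_right_mono) auto
  have "z * cnj z + 24 = of_real (?r ^ 2 + 24)"
    by (simp add: complex_norm_square[symmetric] del: of_real_power)
  then have "cmod ((z * cnj z + 24) * z ^ 2) = (?r ^ 2 + 24) * ?r ^ 2"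
    by (simp add: norm_mult norm_power del: of_real_add)
  then have "cmod (vortex_num d z) \<ge> (?r ^ 2 + 24) * ?r ^ 2 - cmod d * ?r"
    unfolding vortex_num_def using norm_diff_ineq[of "(z * cnj z + 24) * z ^ 2" "d * cnj z"]
    by (simp add: norm_mult)
  moreover have "(?r ^ 2 + 24) * ?r ^ 2 - ?r * ?r = ?r ^ 4 + 23 * ?r ^ 2"
    by algebra
  ultimately show ?thesis
    using \<open>cmod d * ?r \<le> ?r * ?r\<close> zero_le_power2[of ?r] by linarith
qed

text \<open>The defect \<open>1 - (cmod \<psi>)^2\<close> is \<open>(P - Q) / P\<close>, with
  numerator of order \<open>r ^ 6\<close> and denominator at least \<open>r ^ 8\<close>.\<close>

lemma cmod_vortex_bounds:
  assumes "norm p \<ge> 1" "norm p \<ge> cmod d"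
  shows "1 - 50000 / (norm p)\<^sup>2 \<le> (cmod (vortex d p))\<^sup>2" "(cmod (vortex d p))\<^sup>2 \<le> 1"
proof -
  let ?z = "zc p" and ?r = "norm p"
  let ?P = "vortex_den d ?z" and ?Q = "(cmod (vortex_num d ?z))\<^sup>2"
  have r: "cmod ?z = ?r"
    by (simp add: norm_prod_def cmod_def)
  have pos: "?P > 0" and less: "?Q < ?P"
    by (simp_all add: vortex_den_pos vortex_den_gt)
  show "(cmod (vortex d p))\<^sup>2 \<le> 1"
    using pos less by (simp add: cmod_vortex)
  have "(?r ^ 4)\<^sup>2 \<le> ?Q"
    using vortex_num_bound[of ?z d] assms by (intro power_mono) (auto simp: r)
  then have P: "?r ^ 8 \<le> ?P"
    using less by simp
  have r13: "?r ^ 1 \<le> ?r ^ 3" and r02: "?r ^ 0 \<le> ?r ^ 2" and r46: "?r ^ 4 \<le> ?r ^ 6"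
    using assms(1) by (intro power_increasing; simp)+
  have "cmod (2 * d - 4 * ?z ^ 3) \<le> 2 * cmod d + 4 * ?r ^ 3"
    using norm_triangle_ineq4[of "2 * d" "4 * ?z ^ 3"] by (simp add: norm_mult norm_power r)
  also have "\<dots> \<le> 6 * ?r ^ 3"
    using assms(2) r13 by simp
  finally have "(cmod (2 * d - 4 * ?z ^ 3))\<^sup>2 \<le> (6 * ?r ^ 3)\<^sup>2"
    by (intro power_mono) auto
  moreover have "(?r\<^sup>2 + 8)\<^sup>2 \<le> (9 * ?r\<^sup>2)\<^sup>2"
    using r02 by (intro power_mono) auto
  ultimately have "?P - ?Q \<le> 36 * ?r ^ 6 + 576 * (81 * ?r ^ 4)"
    by (simp add: vortex_den_def r power_mult_distrib)
  \<comment> \<open>36 + 576 * 81 = 46692, rounded up.\<close>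
  also have "\<dots> \<le> 50000 * ?r ^ 6"
    using r46 zero_le_power[OF norm_ge_zero, of p 6] by linarith
  finally have "(?P - ?Q) / ?P \<le> 50000 * ?r ^ 6 / ?r ^ 8"
    using P pos less assms(1) by (intro frac_le) auto
  moreover have "50000 * ?r ^ 6 / ?r ^ 8 = 50000 / ?r\<^sup>2"
  proof -
    have nonzero: "?r ^ 8 \<noteq> 0" "?r\<^sup>2 \<noteq> 0"
      using assms(1) by auto
    show ?thesis
      unfolding frac_eq_eq[OF nonzero] by (simp add: mult.assoc flip: power_add)
  qed
  ultimately show "1 - 50000 / ?r\<^sup>2 \<le> (cmod (vortex d p))\<^sup>2"
    using pos by (simp add: cmod_vortex diff_divide_distrib)
qed

lemma cmod_vortex_tendsto: "((\<lambda>p. cmod (vortex d p)) \<longlongrightarrow> 1) at_infinity"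
proof -
  have ev: "\<forall>\<^sub>F p :: real \<times> real in at_infinity. norm p \<ge> 1 \<and> norm p \<ge> cmod d"
    unfolding eventually_at_infinity by (rule exI[of _ "max 1 (cmod d)"]) auto
  have "((\<lambda>p. (cmod (vortex d p))\<^sup>2) \<longlongrightarrow> 1) at_infinity"
  proof (rule tendsto_sandwich)
    show "\<forall>\<^sub>F p in at_infinity. 1 - 50000 / (norm p)\<^sup>2 \<le> (cmod (vortex d p))\<^sup>2"
      using ev by eventually_elim (simp add: cmod_vortex_bounds)
    show "\<forall>\<^sub>F p in at_infinity. (cmod (vortex d p))\<^sup>2 \<le> 1"
      using ev by eventually_elim (simp add: cmod_vortex_bounds)
    have "filterlim (\<lambda>p::real \<times> real. (norm p)\<^sup>2) at_top at_infinity"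
      by (rule filterlim_pow_at_top[OF _ filterlim_norm_at_top]) simp
    then have "((\<lambda>p::real \<times> real. 50000 / (norm p)\<^sup>2) \<longlongrightarrow> 0) at_infinity"
      by (intro tendsto_divide_0[OF tendsto_const] filterlim_at_top_imp_at_infinity)
    then have "((\<lambda>p::real \<times> real. 1 - 50000 / (norm p)\<^sup>2) \<longlongrightarrow> 1 - 0) at_infinity"
      by (intro tendsto_diff tendsto_const)
    then show "((\<lambda>p::real \<times> real. 1 - 50000 / (norm p)\<^sup>2) \<longlongrightarrow> 1) at_infinity"
      by simp
  qed auto
  from tendsto_real_sqrt[OF this] show ?thesis
    by simp
qed

section \<open>Winding number on large circles\<close>

text \<open>The logarithmic derivative of this loop is the constant
  \<open>2 * pi * \<i> * n\<close>, so the contour integral is immediate.\<close>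

lemma winding_number_exp_multiple:
  fixes n :: int
  shows "winding_number (\<lambda>t. exp (2 * pi * \<i> * of_int n * of_real t)) 0 = of_int n"
proof -
  let ?c = "2 * pi * \<i> * of_int n"
  let ?\<gamma> = "\<lambda>t::real. exp (?c * of_real t)"
  have deriv: "(?\<gamma> has_vector_derivative ?c * ?\<gamma> t) (at t)" for t
    by (rule has_vector_derivative_real_field) (auto intro!: derivative_eq_intros)
  have "?\<gamma> C1_differentiable_on {0..1}"
    unfolding C1_differentiable_on_def
    by (rule exI[of _ "\<lambda>t. ?c * ?\<gamma> t"]) (use deriv in \<open>auto intro!: continuous_intros\<close>)
  then have valid: "valid_path ?\<gamma>"
    unfolding valid_path_def by (rule C1_differentiable_imp_piecewise)
  have "((\<lambda>w. 1 / (w - 0)) has_contour_integral ?c) ?\<gamma>"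
    unfolding has_contour_integral
  proof (rule has_integral_eq_rhs[OF has_integral_eq[OF _ has_integral_const_real[of ?c 0 1]]])
    show "?c = 1 / (?\<gamma> t - 0) * vector_derivative ?\<gamma> (at t)" for t
      using vector_derivative_at[OF deriv[of t]] by simp
  qed simp
  then show ?thesis
    using winding_number_valid_path[OF valid, of 0]
    by (simp add: contour_integral_unique path_image_def image_iff)
qed

text \<open>Both endpoints have positive real inner product with \<open>a\<close>, so the segment
  stays in an open half-plane avoiding 0.\<close>

lemma zero_notin_closed_segment:
  assumes "Re (b * cnj a) > 0"
  shows "0 \<notin> closed_segment a b"
proof
  assume "0 \<in> closed_segment a b"
  then obtain u where u: "0 \<le> u" "u \<le> 1" and "(1 - u) *\<^sub>R a + u *\<^sub>R b = 0"
    by (metis in_segment(1))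
  then have "Re (((1 - u) *\<^sub>R a + u *\<^sub>R b) * cnj a) = 0"
    by simp
  then have eq: "(1 - u) * Re (a * cnj a) + u * Re (b * cnj a) = 0"
    by (simp add: algebra_simps)
  have "a \<noteq> 0"
    using assms by auto
  then have "Re (a * cnj a) > 0"
    by (metis Re_complex_of_real complex_norm_square zero_less_norm_iff zero_less_power)
  moreover have "u > 0 \<or> 1 - u > 0"
    by linarith
  ultimately have "(1 - u) * Re (a * cnj a) + u * Re (b * cnj a) > 0"
    using u assms by (auto intro: add_pos_nonneg add_nonneg_pos)
  then show False
    using eq by simp
qed

text \<open>The loop is compared with \<open>u ^ 2\<close> for u on the unit circle: the segment
  between corresponding points misses 0, so the straight-line homotopy preserves the winding
  number.\<close>

lemma winding_number_vortex:
  assumes "R \<ge> 1" "R \<ge> cmod d"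
  shows "winding_number (\<lambda>t. vortex d (R * cos (2 * pi * t), R * sin (2 * pi * t))) 0 = 2"
proof -
  let ?g = "\<lambda>t::real. exp (2 * pi * \<i> * of_int 2 * of_real t)"
  let ?h = "\<lambda>t::real. vortex d (R * cos (2 * pi * t), R * sin (2 * pi * t))"
  have "continuous_on UNIV (vortex d)"
    using CSG2_solution_vortex[of d] unfolding CSG2_solution_def C2_def C1_def
    by (meson continuous_at_imp_continuous_on differentiable_imp_continuous_within)
  then have path: "path ?h"
    unfolding path_def by (rule continuous_on_compose2) (auto intro!: continuous_intros)
  have "winding_number ?h 0 = winding_number ?g 0"
  proof (rule winding_number_loops_linear_eq)
    show "path ?g"
      unfolding path_def by (intro continuous_intros)
    show "path ?h"
      by (rule path)
    show "pathfinish ?g = pathstart ?g"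
      using exp_integer_2pi[of 2] by (simp add: pathfinish_def pathstart_def mult_ac)
    show "pathfinish ?h = pathstart ?h"
      by (simp add: pathfinish_def pathstart_def)
    show "0 \<notin> closed_segment (?g t) (?h t)" for t
    proof (rule zero_notin_closed_segment)
      define u where "u = cis (2 * pi * t)"
      have g: "?g t = u ^ 2"
        unfolding u_def by (simp add: cis_conv_exp exp_of_nat_mult[symmetric] mult_ac)
      have uu: "u * cnj u = 1"
        by (simp add: u_def complex_norm_square[symmetric])
      have z: "zc (R * cos (2 * pi * t), R * sin (2 * pi * t)) = of_real R * u"
        by (simp add: u_def complex_eq_iff)
      \<comment> \<open>\<open>w\<close> is the contribution of \<open>d * cnj z\<close>. Its
        modulus is at most \<open>R ^ 2\<close>, less than the main term
        \<open>(R ^ 2 + 24) * R ^ 2\<close>.\<close>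
      define w where "w = d * of_real R * cnj u * cnj (u ^ 2)"
      have "vortex_num d (of_real R * u) * cnj (u ^ 2)
          = (of_real R ^ 2 * (u * cnj u) + 24) * of_real R ^ 2 * (u * cnj u) ^ 2 + w"
        unfolding vortex_num_def w_def complex_cnj_mult complex_cnj_power complex_cnj_complex_of_real
        by algebra
      also have "\<dots> = of_real ((R ^ 2 + 24) * R ^ 2) + w"
        by (simp add: uu)
      finally have num: "Re (vortex_num d (of_real R * u) * cnj (u ^ 2)) = (R ^ 2 + 24) * R ^ 2 + Re w"
        by simp
      have "cmod w = cmod d * R"
        using assms(1) by (simp add: w_def norm_mult norm_power u_def)
      also have "\<dots> \<le> R * R"
        using assms by (intro mult_right_mono) auto
      finally have "- Re w \<le> R ^ 2"
        using abs_Re_le_cmod[of w] by (simp add: power2_eq_square)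
      moreover have "(R ^ 2 + 24) * R ^ 2 > R ^ 2"
        using assms(1) by (simp add: add_pos_pos algebra_simps)
      ultimately have "Re (vortex_num d (of_real R * u) * cnj (u ^ 2)) > 0"
        unfolding num by linarith
      then have "Re (vortex_num d (of_real R * u) * cnj (u ^ 2)) / sqrt (vortex_den d (of_real R * u)) > 0"
        using vortex_den_pos by simp
      moreover have "?h t * cnj (?g t) = vortex_num d (of_real R * u) * cnj (u ^ 2)
          / of_real (sqrt (vortex_den d (of_real R * u)))"
        unfolding vortex_def z g by simp
      ultimately show "Re (?h t * cnj (?g t)) > 0"
        by (simp only: Re_divide_of_real)
    qed
  qed
  also have "\<dots> = 2"
    using winding_number_exp_multiple[of 2] by simp
  finally show ?thesis .
qed

lemma vortex_solution_vortex: "vortex_solution 2 (vortex d)"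
proof -
  have "\<forall>\<^sub>F R in at_top.
      winding_number (\<lambda>t. vortex d (R * cos (2 * pi * t), R * sin (2 * pi * t))) 0 = of_int 2"
    using eventually_ge_at_top[of 1] eventually_ge_at_top[of "cmod d"]
    by eventually_elim (simp add: winding_number_vortex)
  then show ?thesis
    by (simp add: vortex_solution_def CSG2_solution_vortex cmod_vortex_tendsto)
qed

section \<open>Identification with the given family, and symmetry breaking\<close>

definition twist :: "real \<Rightarrow> complex" where
  "twist \<alpha> = of_real (2 * \<alpha> * (12 + \<alpha>\<^sup>2)) * (\<i> - 1)"

text \<open>In the expansion of \<open>vortex_den_eq_poly\<close>, the odd powers of \<alpha> come
  from \<open>(s + 16) * t\<close> and the positive even ones from
  \<open>d * cnj d * (s + 4)\<close>.\<close>

lemma P_poly_eq_vortex_den: "P_poly \<alpha> x y = vortex_den (twist \<alpha>) (Complex x y)"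
  unfolding vortex_den_def cmod_power2
  by (simp add: P_poly_def vortex_num_def twist_def power2_eq_square power3_eq_cube) algebra

text \<open>In both numerators the \<alpha>-dependent terms of degree 2 and 3 in x, y cancel. What
  survives is linear, with factor \<open>24 * \<alpha> + 2 * \<alpha>^3\<close>, and forms
  \<open>d * cnj z\<close>.\<close>

lemma Psi2_eq_vortex: "Psi2 \<alpha> = vortex (twist \<alpha>)"
proof
  fix p :: "real \<times> real"
  obtain x y where p: "p = (x, y)"
    by (cases p)
  have "beta1 \<alpha> x y * (x^2 - y^2 - \<alpha> * x + \<alpha> * y) + beta2 \<alpha> x y * (2 * x * y + \<alpha> * x + \<alpha> * y)
      = Re (vortex_num (twist \<alpha>) (Complex x y))"
    by (simp add: beta1_def beta2_def vortex_num_def twist_def power2_eq_square) algebra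
  moreover have "gamma1 \<alpha> x y * (2 * x * y + \<alpha> * x + \<alpha> * y) + gamma2 \<alpha> x y * (x^2 - y^2 - \<alpha> * x + \<alpha> * y)
      = Im (vortex_num (twist \<alpha>) (Complex x y))"
    by (simp add: gamma1_def gamma2_def vortex_num_def twist_def power2_eq_square) algebra
  ultimately show "Psi2 \<alpha> p = vortex (twist \<alpha>) p"
    by (simp add: Psi2_def vortex_def p P_poly_eq_vortex_den complex_eq_iff)
qed

text \<open>The points i and -i lie on one circle, but the part of the denominator and of the
  squared numerator that is linear in \<open>d\<close> changes sign under z to -z.\<close>

lemma not_symmetric_modulus_vortex:
  assumes "\<alpha> > 0"
  shows "\<not> symmetric_modulus (vortex (twist \<alpha>))"
proof
  define k where "k = 2 * \<alpha> * (12 + \<alpha>\<^sup>2)"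
  have "12 + \<alpha>\<^sup>2 > 0"
    by (simp add: add_pos_nonneg)
  then have k: "k > 0"
    using assms by (simp add: k_def)
  \<comment> \<open>The parts even in \<open>k\<close> of Q and of P - Q, common to both
    points.\<close>
  define A B where "A = 2 * k\<^sup>2 + 625" and "B = 8 * k\<^sup>2 + 46672"
  have pos: "A > 0" "B > 0"
    by (simp_all add: A_def B_def add_nonneg_pos)
  have num: "(cmod (vortex_num (twist \<alpha>) (Complex 0 1)))\<^sup>2 = A - 50 * k"
     "(cmod (vortex_num (twist \<alpha>) (Complex 0 (-1))))\<^sup>2 = A + 50 * k"
    unfolding cmod_power2 vortex_num_def twist_def k_def[symmetric] A_def
    by (simp_all add: power2_eq_square algebra_simps)
  have den: "vortex_den (twist \<alpha>) (Complex 0 1) = A - 50 * k + (B + 16 * k)"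
     "vortex_den (twist \<alpha>) (Complex 0 (-1)) = A + 50 * k + (B - 16 * k)"
    unfolding vortex_den_def num unfolding cmod_power2 twist_def k_def[symmetric] B_def
    by (simp_all add: power2_eq_square power3_eq_cube algebra_simps)
  assume "symmetric_modulus (vortex (twist \<alpha>))"
  then obtain f where f: "\<And>x y. cmod (vortex (twist \<alpha>) (x, y)) = f (sqrt (x\<^sup>2 + y\<^sup>2))"
    unfolding symmetric_modulus_def by blast
  have "(cmod (vortex (twist \<alpha>) (0, 1)))\<^sup>2 = (cmod (vortex (twist \<alpha>) (0, -1)))\<^sup>2"
    by (simp add: f)
  then have "(A - 50 * k) / (A - 50 * k + (B + 16 * k)) = (A + 50 * k) / (A + 50 * k + (B - 16 * k))"
    unfolding cmod_vortex fst_conv snd_conv num den .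
  moreover have "A - 50 * k + (B + 16 * k) > 0" "A + 50 * k + (B - 16 * k) > 0"
    unfolding den[symmetric] by (rule vortex_den_pos)+
  ultimately have "(A - 50 * k) * (A + 50 * k + (B - 16 * k)) = (A + 50 * k) * (A - 50 * k + (B + 16 * k))"
    by (simp only: frac_eq_eq less_imp_neq[THEN not_sym] simp_thms)
  \<comment> \<open>Cross-multiplication reduces to
    \<open>(A - 50 * k) * (B - 16 * k) = (A + 50 * k) * (B + 16 * k)\<close>, of which only the
    terms odd in \<open>k\<close> remain.\<close>
  then have "k * (32 * A + 100 * B) = 0"
    by algebra
  then show False
    using k pos by simp
qed

theorem theorem1:
  fixes \<alpha> :: real
  assumes "\<alpha> \<ge> 0"
  shows "(\<forall>x y. P_poly \<alpha> x y > 0) \<and>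
         vortex_solution 2 (Psi2 \<alpha>) \<and>
         (\<alpha> > 0 \<longrightarrow> \<not> symmetric_modulus (Psi2 \<alpha>))"
  unfolding Psi2_eq_vortex P_poly_eq_vortex_den
  using vortex_den_pos vortex_solution_vortex not_symmetric_modulus_vortex by blast

end
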